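(* Let $G$ be a topological rough group with rough identity element $e$ such that $G$ (with the topology $\tau_G$) is a $T_1$-space. If $e\in G$, then for each $g\in G\setminus\{e\}$ there exist open neighborhoods $U$ of $e$ and $V$ of $g$ in $G$ such that $U\cap V=\emptyset$.
   Context: An approximation space $(X,R)$ is a non-empty set $X$ with an equivalence relation $R$; for $A\subset X$ the upper approximation is $\overline{A}=\{x\in X:[x]_R\cap A\neq\emptyset\}$, where $[x]_R$ is the equivalence class of $x$. Let $X$ carry a binary operation, written $xy$. A subset $G\subset X$ is a rough group if: (1) $xy\in\overline{G}$ for all $x,y\in G$; (2) $(xy)z=x(yz)$ for all $x,y,z\in\overline{G}$; (3) there is $e\in\overline{G}$ (the rough identity element) with $ex=xe=x$ for all $x\in\overline{G}$; (4) for every $x\in G$ there is $y\in G$ with $xy=yx=e$ (written $y=x^{-1}$). A topological rough group is a rough group $G$ together with a topology $\tau$ on $\overline{G}$ such that, with $\tau_G$ the subspace topology on $G$, the multiplication $G\times G\to\overline{G}$, $(x,y)\mapsto xy$, is continuous (product topology of $\tau_G$ on $G\times G$, $\tau$ on $\overline{G}$) and the inverse mapping $G\to G$, $x\mapsto x^{-1}$, is continuous for $\tau_G$. *)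

theory Defs
  imports "HOL-Analysis.Analysis"
begin

definition upper_approx :: "'a set \<Rightarrow> ('a \<times> 'a) set \<Rightarrow> 'a set \<Rightarrow> 'a set" where
  "upper_approx X R A = {x \<in> X. (R `` {x}) \<inter> A \<noteq> {}}"

locale approximation_space =
  fixes X :: "'a set" and R :: "('a \<times> 'a) set"
  assumes nonempty: "X \<noteq> {}"
    and equiv: "equiv X R"

text \<open>
  The rough identity element \<open>e\<close> is a parameter of the locale. It is determined by the
  other data, since any two elements of the upper approximation that satisfy
  \<open>identity\<close> coincide.
\<close>

locale rough_group = approximation_space X R
  for X :: "'a set" and R :: "('a \<times> 'a) set" +
  fixes mul :: "'a \<Rightarrow> 'a \<Rightarrow> 'a" and G :: "'a set" and e :: 'a
  assumes mul_closed: "\<And>x y. x \<in> X \<Longrightarrow> y \<in> X \<Longrightarrow> mul x y \<in> X"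
    and subset: "G \<subseteq> X"
    and mul_upper: "\<And>x y. x \<in> G \<Longrightarrow> y \<in> G \<Longrightarrow> mul x y \<in> upper_approx X R G"
    and assoc: "\<And>x y z. x \<in> upper_approx X R G \<Longrightarrow> y \<in> upper_approx X R G \<Longrightarrow>
      z \<in> upper_approx X R G \<Longrightarrow> mul (mul x y) z = mul x (mul y z)"
    and identity_upper: "e \<in> upper_approx X R G"
    and identity: "\<And>x. x \<in> upper_approx X R G \<Longrightarrow> mul e x = x \<and> mul x e = x"
    and inverse: "\<And>x. x \<in> G \<Longrightarrow> \<exists>y\<in>G. mul x y = e \<and> mul y x = e"

definition rough_inv :: "('a \<Rightarrow> 'a \<Rightarrow> 'a) \<Rightarrow> 'a set \<Rightarrow> 'a \<Rightarrow> 'a \<Rightarrow> 'a" where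
  "rough_inv mul G e x = (THE y. y \<in> G \<and> mul x y = e \<and> mul y x = e)"

context rough_group
begin

lemma subset_upper: "G \<subseteq> upper_approx X R G"
  using subset equiv by (auto simp: upper_approx_def equiv_def refl_on_def)

lemma ex1_inverse:
  assumes "x \<in> G"
  shows "\<exists>!y. y \<in> G \<and> mul x y = e \<and> mul y x = e"
proof -
  have "y = z" if "y \<in> G" "mul y x = e" "z \<in> G" "mul x z = e" for y z
    using that assms subset_upper assoc[of y x z] identity[of y] identity[of z] by auto
  then show ?thesis using inverse[OF assms] by blast
qed

lemma rough_inv:
  assumes "x \<in> G"
  shows "rough_inv mul G e x \<in> G" "mul x (rough_inv mul G e x) = e"
    "mul (rough_inv mul G e x) x = e"
  using theI'[OF ex1_inverse[OF assms]] by (auto simp: rough_inv_def)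

end

locale topological_rough_group = rough_group X R mul G e
  for X :: "'a set" and R :: "('a \<times> 'a) set" and mul :: "'a \<Rightarrow> 'a \<Rightarrow> 'a"
    and G :: "'a set" and e :: 'a +
  fixes T :: "'a topology"
  assumes topspace: "topspace T = upper_approx X R G"
    and continuous_mul: "continuous_map (prod_topology (subtopology T G) (subtopology T G)) T
      (\<lambda>(x, y). mul x y)"
    and continuous_inv: "continuous_map (subtopology T G) (subtopology T G) (rough_inv mul G e)"

end

theory Submission
  imports Defs
begin

text \<open>
  The map \<open>(x, y) \<mapsto> x\<inverse>y\<close> is continuous on \<open>G \<times> G\<close>, sends \<open>(e, g)\<close> to \<open>g\<close> and the diagonal
  to \<open>e\<close>. Since \<open>G\<close> is \<open>T\<^sub>1\<close> and \<open>e \<in> G\<close>, some open set of the upper approximation contains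
  \<open>g\<close> but not \<open>e\<close>; any open box around \<open>(e, g)\<close> in its preimage misses the diagonal.
\<close>

context topological_rough_group
begin

lemma topspace_subtopology_G: "topspace (subtopology T G) = G"
  using subset_upper by (auto simp: topspace)

text \<open>The product of \<open>e\<close> with its inverse equals \<open>e\<close> by the inverse
  law and that inverse by the identity law.\<close>

lemma rough_inv_identity: "e \<in> G \<Longrightarrow> rough_inv mul G e e = e"
  using rough_inv(1,2)[of e] identity subset_upper by (metis subsetD)

lemma continuous_map_inv_mul:
  "continuous_map (prod_topology (subtopology T G) (subtopology T G)) T
    (\<lambda>(x, y). mul (rough_inv mul G e x) y)"
proof -
  \<comment> \<open>Inversion maps \<open>G\<close> into \<open>G\<close>, so this map stays within
    \<open>G \<times> G\<close>, where multiplication is assumed continuous.\<close>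
  have "continuous_map (prod_topology (subtopology T G) (subtopology T G))
      (prod_topology (subtopology T G) (subtopology T G))
      (\<lambda>p. (rough_inv mul G e (fst p), snd p))"
    using continuous_map_compose[OF continuous_map_fst continuous_inv]
    by (simp add: continuous_map_pairwise o_def continuous_map_snd)
  from continuous_map_compose[OF this continuous_mul]
  show ?thesis by (simp add: o_def case_prod_unfold)
qed

lemma separate_identity:
  assumes t1: "t1_space (subtopology T G)" and e: "e \<in> G" and g: "g \<in> G" "g \<noteq> e"
  obtains U V where "openin (subtopology T G) U" "e \<in> U"
    "openin (subtopology T G) V" "g \<in> V" "U \<inter> V = {}"
proof -
  let ?S = "subtopology T G"
  obtain W where W: "openin T W" "g \<in> W" "e \<notin> W"
  proof -
    obtain W' where "openin ?S W'" "g \<in> W'" "e \<notin> W'"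
      using t1 e g unfolding t1_space_def topspace_subtopology_G by metis
    \<comment> \<open>\<open>W'\<close> is the trace on \<open>G\<close> of a \<open>T\<close>-open
      set \<open>W\<close>; since \<open>e\<close> lies in \<open>G\<close> but not in
      \<open>W'\<close>, it cannot lie in \<open>W\<close>.\<close>
    then show ?thesis using that e unfolding openin_subtopology by blast
  qed
  define P where "P = {p \<in> topspace (prod_topology ?S ?S).
    (\<lambda>(x, y). mul (rough_inv mul G e x) y) p \<in> W}"
  have "openin (prod_topology ?S ?S) P"
    unfolding P_def by (rule openin_continuous_map_preimage[OF continuous_map_inv_mul W(1)])
  moreover have "(e, g) \<in> P"
    using e g W(2) identity[of g] subset_upper rough_inv_identity[OF e]
    by (simp add: P_def topspace subset_iff)
  ultimately obtain U V where UV: "openin ?S U" "openin ?S V" "e \<in> U" "g \<in> V" "U \<times> V \<subseteq> P"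
    unfolding openin_prod_topology_alt by metis
  have "U \<inter> V = {}"
  proof (rule ccontr)
    assume "U \<inter> V \<noteq> {}"
    \<comment> \<open>A common point \<open>x\<close> puts the diagonal pair in \<open>P\<close>, so
      its image \<open>e\<close> would lie in \<open>W\<close>, which was chosen to avoid
      \<open>e\<close>.\<close>
    then obtain x where "(x, x) \<in> P" using UV(5) by (metis disjoint_iff mem_Sigma_iff subsetD)
    then have "mul (rough_inv mul G e x) x \<in> W" "x \<in> G"
      by (simp_all add: P_def topspace_subtopology_G)
    then show False using rough_inv(3) W(3) by simp
  qed
  with UV show thesis using that by metis
qed

end

theorem proposition3p13:
  fixes X :: "'a set" and R :: "('a \<times> 'a) set" and mul :: "'a \<Rightarrow> 'a \<Rightarrow> 'a"
    and G :: "'a set" and e :: 'a and T :: "'a topology"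
  assumes "topological_rough_group X R mul G e T"
    and "t1_space (subtopology T G)"
    and "e \<in> G"
  shows "\<forall>g \<in> G - {e}. \<exists>U V. openin (subtopology T G) U \<and> e \<in> U \<and>
    openin (subtopology T G) V \<and> g \<in> V \<and> U \<inter> V = {}"
proof
  fix g assume "g \<in> G - {e}"
  then have "g \<in> G" "g \<noteq> e" by auto
  from topological_rough_group.separate_identity[OF assms this]
  show "\<exists>U V. openin (subtopology T G) U \<and> e \<in> U \<and>
    openin (subtopology T G) V \<and> g \<in> V \<and> U \<inter> V = {}" by metis
qed

end
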